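(* Let $p$ be a prime number, $k$ a natural number and $X:=\{0,\dots,p^k-1\}$. Let $n\ge 2$ be an integer and let $j_0,\dots,j_n$ be non-negative integers with $j_n=0$, $j_0=k$ and $j_i<j_{i-1}$ for every $i\in\{1,\dots,n\}$. Let $\{f_i\}_{i\in\{1,\dots,n-1\}}$ be functions $$f_i:\mathbb{Z}/p^{j_i}\mathbb{Z}\longrightarrow\{0,\dots,p^{j_{i-1}}/p^{j_i}-1\}$$ such that $f_i(0)=0$ for every $i\in\{1,\dots,n-1\}$ and such that, for every $i\in\{1,\dots,n-1\}$, the function $$\varphi_i:\{0,\dots,p^{j_i}-1\}\longrightarrow\{1,\dots,p^{j_{i-1}}-1\},\qquad l\mapsto 1+p^{j_{n-1}}f_{n-1}(l)+\dots+p^{j_i}f_i(l)=1+\sum_{m=i}^{n-1}p^{j_m}f_m(l)$$ is injective. Let $\psi\in Sym(X)$ be the cycle $(0\;1\;\dots\;p^k-1)$ and define, for every $i\in X$, $$\sigma_i:=\psi^{1+\sum_{m=1}^{n-1}p^{j_m}f_m(i)}.$$ For $i,j\in X$ put $$K_{j,i}:=j+1+\sum_{m=2}^{n-1}p^{j_m}f_m(i),\qquad Q_{j,i}:=\sum_{m=1}^{n-1}p^{j_m}f_m(i)+\sum_{m=1}^{n-1}p^{j_m}f_m(K_{j,i}),$$ and suppose that $Q_{i,j}\equiv Q_{j,i}\pmod{p^k}$ for every $i,j\in X$. Then $X$, with the operation $i\cdot j:=\sigma_i(j)$, is an indecomposable cycle set of multipermutational level $n$ with cyclic permutation group $\mathcal{G}(X)=\langle\psi\rangle$,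 and $|\sigma^i(X)|=p^{j_i}$ for every $i\in\{0,\dots,n\}$.
   Context: A cycle set is a non-empty set $X$ with a binary operation $\cdot$ such that every left multiplication $\sigma_x:X\to X,\ y\mapsto x\cdot y$ is bijective and $(x\cdot y)\cdot(x\cdot z)=(y\cdot x)\cdot(y\cdot z)$ for all $x,y,z\in X$. The permutation group $\mathcal{G}(X)$ is the subgroup of $Sym(X)$ generated by $\{\sigma_x\mid x\in X\}$. $X$ is indecomposable if there is no partition $\{Y,Z\}$ of $X$ into non-empty subsets with $\sigma_x(Y)\subseteq Y$ and $\sigma_x(Z)\subseteq Z$ for all $x\in X$ (equivalently, $\mathcal{G}(X)$ is transitive on $X$). For a non-degenerate cycle set (i.e. $x\mapsto x\cdot x$ is bijective; every finite cycle set is non-degenerate) the retraction is the cycle set $\sigma(X):=\{\sigma_x\mid x\in X\}$ with $\sigma_x\cdot\sigma_y:=\sigma_{x\cdot y}$; one puts $\sigma^0(X):=X$, $\sigma^m(X):=\sigma(\sigma^{m-1}(X))$ for $m\ge1$. $X$ is multipermutational of level $m$ if $m$ is the minimal non-negative integer with $|\sigma^m(X)|=1$. When an integer $l$ is given as argument to a function $f_m$ defined on $\mathbb{Z}/p^{j_m}\mathbb{Z}$, $f_m(l)$ means the value of $f_m$ at the class of $l$ modulo $p^{j_m}$. Empty sums are $0$. *)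

theory Defs
  imports "HOL-Algebra.Bij" "HOL-Algebra.Elementary_Groups" "HOL-Combinatorics.Cycles" "HOL-Number_Theory.Cong"
begin

record 'a lmagma = "'a partial_object" +
  dot :: "'a \<Rightarrow> 'a \<Rightarrow> 'a" (infixl "\<cdot>\<index>" 70)

locale cycle_set =
  fixes X :: "('a, 'b) lmagma_scheme" (structure)
  assumes nonempty: "carrier X \<noteq> {}"
    and left_bij: "x \<in> carrier X \<Longrightarrow> bij_betw (\<lambda>y. x \<cdot> y) (carrier X) (carrier X)"
    and cycle_law: "\<lbrakk>x \<in> carrier X; y \<in> carrier X; z \<in> carrier X\<rbrakk>
      \<Longrightarrow> (x \<cdot> y) \<cdot> (x \<cdot> z) = (y \<cdot> x) \<cdot> (y \<cdot> z)"

definition left_mult :: "('a, 'b) lmagma_scheme \<Rightarrow> 'a \<Rightarrow> 'a \<Rightarrow> 'a" where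
  "left_mult X x = (\<lambda>y\<in>carrier X. x \<cdot>\<^bsub>X\<^esub> y)"

definition perm_group :: "('a, 'b) lmagma_scheme \<Rightarrow> ('a \<Rightarrow> 'a) monoid" where
  "perm_group X = subgroup_generated (BijGroup (carrier X)) (left_mult X ` carrier X)"

definition indecomposable :: "('a, 'b) lmagma_scheme \<Rightarrow> bool" where
  "indecomposable X \<longleftrightarrow>
    \<not> (\<exists>Y Z. Y \<noteq> {} \<and> Z \<noteq> {} \<and> Y \<inter> Z = {} \<and> Y \<union> Z = carrier X \<and>
        (\<forall>x\<in>carrier X. left_mult X x ` Y \<subseteq> Y \<and> left_mult X x ` Z \<subseteq> Z))"

definition nondegenerate :: "('a, 'b) lmagma_scheme \<Rightarrow> bool" where
  "nondegenerate X \<longleftrightarrow> bij_betw (\<lambda>x. x \<cdot>\<^bsub>X\<^esub> x) (carrier X) (carrier X)"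

definition retraction :: "('a, 'b) lmagma_scheme \<Rightarrow> ('a \<Rightarrow> 'a) lmagma" where
  "retraction X =
    \<lparr>carrier = left_mult X ` carrier X,
     dot = (\<lambda>s t. THE u. \<exists>x\<in>carrier X. \<exists>y\<in>carrier X.
       s = left_mult X x \<and> t = left_mult X y \<and> u = left_mult X (x \<cdot>\<^bsub>X\<^esub> y))\<rparr>"

definition transport :: "('a \<Rightarrow> 'c) \<Rightarrow> ('a, 'b) lmagma_scheme \<Rightarrow> 'c lmagma" where
  "transport h X =
    \<lparr>carrier = h ` carrier X,
     dot = (\<lambda>a b. h (inv_into (carrier X) h a \<cdot>\<^bsub>X\<^esub> inv_into (carrier X) h b))\<rparr>"

text \<open>
  The elements of \<open>retraction X\<close> are functions on the elements of \<open>X\<close>, so that iterating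
  \<open>retraction\<close> literally would change the type at each step. The iteration below uses
  instead the copy of the retraction on the original type that is obtained by renaming
  each permutation \<open>s\<close> of the retraction to a chosen \<open>x\<close> with \<open>left_mult X x = s\<close>.
  By \<open>retraction_copy_iso\<close> this is an isomorphic copy, and by \<open>retraction_iso\<close> the
  retraction preserves isomorphism of cycle sets, so the choices affect the iterates only
  up to isomorphism as long as these are cycle sets (as for every finite \<open>X\<close>).
\<close>

definition retraction_copy :: "('a, 'b) lmagma_scheme \<Rightarrow> 'a lmagma" where
  "retraction_copy X = transport (inv_into (carrier X) (left_mult X)) (retraction X)"

definition iter_retraction :: "nat \<Rightarrow> 'a lmagma \<Rightarrow> 'a lmagma" where
  "iter_retraction m X = (retraction_copy ^^ m) X"

definition multipermutational_level :: "'a lmagma \<Rightarrow> nat \<Rightarrow> bool" where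
  "multipermutational_level X m \<longleftrightarrow>
    nondegenerate X \<and>
    card (carrier (iter_retraction m X)) = 1 \<and>
    (\<forall>i<m. card (carrier (iter_retraction i X)) \<noteq> 1)"

definition lmagma_iso ::
    "('a \<Rightarrow> 'c) \<Rightarrow> ('a, 'b) lmagma_scheme \<Rightarrow> ('c, 'd) lmagma_scheme \<Rightarrow> bool" where
  "lmagma_iso h X Y \<longleftrightarrow> bij_betw h (carrier X) (carrier Y) \<and>
    (\<forall>x\<in>carrier X. \<forall>y\<in>carrier X. x \<cdot>\<^bsub>X\<^esub> y \<in> carrier X \<and> h (x \<cdot>\<^bsub>X\<^esub> y) = h x \<cdot>\<^bsub>Y\<^esub> h y)"

lemma left_mult_eq_iff:
  "left_mult X x = left_mult X x' \<longleftrightarrow> (\<forall>z\<in>carrier X. x \<cdot>\<^bsub>X\<^esub> z = x' \<cdot>\<^bsub>X\<^esub> z)"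
  by (auto simp: left_mult_def fun_eq_iff restrict_def)

context cycle_set
begin

lemma dot_closed: "\<lbrakk>x \<in> carrier X; y \<in> carrier X\<rbrakk> \<Longrightarrow> x \<cdot> y \<in> carrier X"
  using left_bij by (auto simp: bij_betw_def)

lemma left_mult_in_Bij: "x \<in> carrier X \<Longrightarrow> left_mult X x \<in> Bij (carrier X)"
  using left_bij[of x] by (auto simp: left_mult_def Bij_def cong: bij_betw_cong)

lemma left_mult_eqD: "\<lbrakk>left_mult X x = left_mult X x'; z \<in> carrier X\<rbrakk> \<Longrightarrow> x \<cdot> z = x' \<cdot> z"
  by (simp add: left_mult_eq_iff)

lemma retraction_well_defined:
  assumes c: "x \<in> carrier X" "x' \<in> carrier X" "y \<in> carrier X" "y' \<in> carrier X"
    and x: "left_mult X x = left_mult X x'" and y: "left_mult X y = left_mult X y'"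
  shows "left_mult X (x \<cdot> y) = left_mult X (x' \<cdot> y')"
proof -
  have "(x \<cdot> y) \<cdot> w = (x \<cdot> y') \<cdot> w" if w: "w \<in> carrier X" for w
  proof -
    obtain z where z: "z \<in> carrier X" "w = x \<cdot> z"
      using left_bij[OF c(1)] w by (auto simp: bij_betw_def)
    show ?thesis
      using c z cycle_law[of x y z] cycle_law[of x y' z] left_mult_eqD[OF y] by simp
  qed
  then have "left_mult X (x \<cdot> y) = left_mult X (x \<cdot> y')"
    by (auto simp: left_mult_def)
  then show ?thesis
    using left_mult_eqD[OF x c(4)] by simp
qed

lemma retraction_dot:
  assumes "x \<in> carrier X" "y \<in> carrier X"
  shows "left_mult X x \<cdot>\<^bsub>retraction X\<^esub> left_mult X y = left_mult X (x \<cdot> y)"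
proof -
  have "(THE u. \<exists>x'\<in>carrier X. \<exists>y'\<in>carrier X. left_mult X x = left_mult X x' \<and>
      left_mult X y = left_mult X y' \<and> u = left_mult X (x' \<cdot> y')) = left_mult X (x \<cdot> y)"
    (is "The ?P = ?s")
  proof (rule the_equality)
    show "?P ?s" using assms by blast
  next
    fix u assume "?P u"
    then obtain x' y' where "x' \<in> carrier X" "y' \<in> carrier X"
      "left_mult X x = left_mult X x'" "left_mult X y = left_mult X y'"
      "u = left_mult X (x' \<cdot> y')" by blast
    then show "u = ?s" using retraction_well_defined[of x x' y y'] assms by simp
  qed
  then show ?thesis by (simp add: retraction_def)
qed

lemma retraction_copy_iso:
  "lmagma_iso (inv_into (carrier X) (left_mult X)) (retraction X) (retraction_copy X)"
proof -
  let ?h = "inv_into (carrier X) (left_mult X)"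
  have inj: "inj_on ?h (carrier (retraction X))"
    by (simp add: retraction_def inj_on_inv_into)
  have "s \<cdot>\<^bsub>retraction X\<^esub> t \<in> carrier (retraction X)"
    if "s \<in> carrier (retraction X)" "t \<in> carrier (retraction X)" for s t
  proof -
    obtain x y where "x \<in> carrier X" "y \<in> carrier X" "s = left_mult X x" "t = left_mult X y"
      using \<open>s \<in> _\<close> \<open>t \<in> _\<close> by (auto simp: retraction_def)
    then have "s \<cdot>\<^bsub>retraction X\<^esub> t = left_mult X (x \<cdot> y)" "x \<cdot> y \<in> carrier X"
      using retraction_dot dot_closed by auto
    then show ?thesis
      by (simp add: retraction_def)
  qed
  with inj show ?thesis
    by (auto simp: lmagma_iso_def retraction_copy_def transport_def bij_betw_def)
qed

lemma retraction_iso: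
  assumes h: "lmagma_iso h X Y"
  shows "\<exists>g. lmagma_iso g (retraction X) (retraction Y) \<and>
    (\<forall>x\<in>carrier X. g (left_mult X x) = left_mult Y (h x))"
proof -
  have bij: "bij_betw h (carrier X) (carrier Y)" using h by (simp add: lmagma_iso_def)
  have inj: "inj_on h (carrier X)" and im: "h ` carrier X = carrier Y"
    using bij by (auto simp: bij_betw_def)
  have hom: "h (x \<cdot> y) = h x \<cdot>\<^bsub>Y\<^esub> h y" if "x \<in> carrier X" "y \<in> carrier X" for x y
    using h that by (simp add: lmagma_iso_def)
  have eq: "left_mult Y (h x) = left_mult Y (h x') \<longleftrightarrow> left_mult X x = left_mult X x'"
    if "x \<in> carrier X" "x' \<in> carrier X" for x x'
  proof -
    have "left_mult Y (h x) = left_mult Y (h x') \<longleftrightarrow>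
        (\<forall>b\<in>carrier Y. h x \<cdot>\<^bsub>Y\<^esub> b = h x' \<cdot>\<^bsub>Y\<^esub> b)"
      by (rule left_mult_eq_iff)
    also have "\<dots> \<longleftrightarrow> (\<forall>z\<in>carrier X. h (x \<cdot> z) = h (x' \<cdot> z))"
      using that hom by (auto simp flip: im)
    also have "\<dots> \<longleftrightarrow> (\<forall>z\<in>carrier X. x \<cdot> z = x' \<cdot> z)"
      using that by (intro ball_cong refl inj_on_eq_iff[OF inj] dot_closed)
    also have "\<dots> \<longleftrightarrow> left_mult X x = left_mult X x'"
      by (rule left_mult_eq_iff[symmetric])
    finally show ?thesis .
  qed
  have Y: "cycle_set Y"
  proof
    show "carrier Y \<noteq> {}" using nonempty im by auto
  next
    fix b assume "b \<in> carrier Y"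
    then obtain x where x: "x \<in> carrier X" "b = h x" using im by auto
    have "bij_betw (h \<circ> (\<lambda>y. x \<cdot> y)) (carrier X) (carrier Y)"
      using bij_betw_trans[OF left_bij[OF x(1)] bij] .
    then have "bij_betw ((\<lambda>c. b \<cdot>\<^bsub>Y\<^esub> c) \<circ> h) (carrier X) (carrier Y)"
      using x hom by (auto cong: bij_betw_cong)
    then show "bij_betw (\<lambda>c. b \<cdot>\<^bsub>Y\<^esub> c) (carrier Y) (carrier Y)"
      using bij_betw_comp_iff[OF bij] by blast
  next
    fix a b c assume "a \<in> carrier Y" "b \<in> carrier Y" "c \<in> carrier Y"
    then obtain x y z where "x \<in> carrier X" "y \<in> carrier X" "z \<in> carrier X"
      "a = h x" "b = h y" "c = h z" unfolding im[symmetric] by blast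
    then show "(a \<cdot>\<^bsub>Y\<^esub> b) \<cdot>\<^bsub>Y\<^esub> (a \<cdot>\<^bsub>Y\<^esub> c) = (b \<cdot>\<^bsub>Y\<^esub> a) \<cdot>\<^bsub>Y\<^esub> (b \<cdot>\<^bsub>Y\<^esub> c)"
      using cycle_law[of x y z] by (simp add: dot_closed flip: hom)
  qed
  define g where "g s = left_mult Y (h (inv_into (carrier X) (left_mult X) s))" for s
  have g: "g (left_mult X x) = left_mult Y (h x)" if x: "x \<in> carrier X" for x
    unfolding g_def
    using eq[of "inv_into (carrier X) (left_mult X) (left_mult X x)" x] x
    by (simp add: inv_into_into f_inv_into_f)
  have "bij_betw g (carrier (retraction X)) (carrier (retraction Y))"
    unfolding bij_betw_def
  proof
    show "inj_on g (carrier (retraction X))"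
      by (auto simp: inj_on_def retraction_def g eq)
    have "g ` carrier (retraction X) = (\<lambda>x. left_mult Y (h x)) ` carrier X"
      using g by (auto simp: retraction_def image_image)
    also have "\<dots> = carrier (retraction Y)"
      by (simp add: retraction_def image_image flip: im)
    finally show "g ` carrier (retraction X) = carrier (retraction Y)" .
  qed
  moreover have "s \<cdot>\<^bsub>retraction X\<^esub> t \<in> carrier (retraction X) \<and>
      g (s \<cdot>\<^bsub>retraction X\<^esub> t) = g s \<cdot>\<^bsub>retraction Y\<^esub> g t"
    if st: "s \<in> carrier (retraction X)" "t \<in> carrier (retraction X)" for s t
  proof -
    obtain x y where xy: "x \<in> carrier X" "y \<in> carrier X" "s = left_mult X x" "t = left_mult X y"
      using st by (auto simp: retraction_def)
    then have hxy: "h x \<in> carrier Y" "h y \<in> carrier Y" using im by auto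
    have "s \<cdot>\<^bsub>retraction X\<^esub> t = left_mult X (x \<cdot> y)"
      using xy retraction_dot by simp
    moreover have "left_mult X (x \<cdot> y) \<in> carrier (retraction X)"
      using xy dot_closed by (simp add: retraction_def)
    moreover have "g s \<cdot>\<^bsub>retraction Y\<^esub> g t = left_mult Y (h x \<cdot>\<^bsub>Y\<^esub> h y)"
      using xy g cycle_set.retraction_dot[OF Y hxy] by simp
    ultimately show ?thesis
      using xy g[OF dot_closed[OF xy(1,2)]] hom by simp
  qed
  ultimately have "lmagma_iso g (retraction X) (retraction Y)"
    by (simp add: lmagma_iso_def)
  with g show ?thesis by blast
qed

end

end

theory Submission
  imports Defs
begin

text \<open>
  The theorem compares the cycle set with an explicit tower of quotients. Put
  \<open>N i = p ^ j i\<close> and \<open>s i x = (\<Sum>m=i..<n. N m * F m x)\<close>, so that each \<open>N (i + 1)\<close> divides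
  \<open>N i\<close>, the value \<open>s i x\<close> depends only on \<open>x\<close> modulo \<open>N i\<close> for \<open>i \<ge> 1\<close>, and \<open>x \<cdot> y = y + 1 + s 1 x\<close>
  modulo \<open>N 0\<close>. Both sides of the cycle law applied to \<open>z\<close> are \<open>z + 2\<close> plus one of the two
  sums \<open>Q y x\<close>, \<open>Q x y\<close>, so the law is exactly the symmetry of \<open>Q\<close>.

  Modulo \<open>N i\<close> the summands of \<open>s 1\<close> up to index \<open>i\<close> vanish. Hence reduction modulo \<open>N i\<close>
  carries the operation to \<open>(x, y) \<mapsto> y + 1 + s (i + 1) x\<close> on the integers modulo \<open>N i\<close>. Two
  elements of this quotient act in the same way iff \<open>s (i + 1)\<close> takes congruent values on them,
  which by the injectivity of \<open>\<phi>\<close> at index \<open>i + 1\<close> happens iff they agree modulo \<open>N (i + 1)\<close>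
  (for \<open>i = n - 1\<close> the sum is empty and \<open>N n = 1\<close>, so both conditions always hold).
  So the retraction of the \<open>i\<close>-th quotient is the next one, and \<open>iter_retraction_iso_level\<close>
  identifies the \<open>i\<close>-th retraction with the integers modulo \<open>N i\<close>; this gives the cardinalities
  and the multipermutation level.

  The squaring map \<open>x \<mapsto> x + 1 + s 1 x\<close> is triangular along the tower: if two elements with the
  same square agree modulo \<open>N (r + 1)\<close>, then they have the same \<open>s (r + 1)\<close> and so agree modulo
  \<open>N r\<close>. Starting from \<open>N n = 1\<close> this proves non-degeneracy (\<open>nondegenerate_C\<close>). Finally all left
  multiplications are powers of the full cycle \<open>\<psi>\<close>, and \<open>\<psi>\<close> itself is the left multiplication by
  \<open>0\<close>, since every \<open>F m\<close> vanishes at \<open>0\<close>; this determines the permutation group and makes it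
  transitive.
\<close>

section \<open>Retractions of finite cycle sets\<close>

text \<open>
  Surjectivity of the left multiplications and the cycle law pass to every homomorphic image;
  finiteness turns surjectivity back into bijectivity.
\<close>

lemma hom_image_finite_cycle_set:
  assumes X: "cycle_set X" and fin: "finite (carrier X)"
    and im: "h ` carrier X = carrier Y"
    and hom: "\<And>x y. \<lbrakk>x \<in> carrier X; y \<in> carrier X\<rbrakk>
      \<Longrightarrow> h (x \<cdot>\<^bsub>X\<^esub> y) = h x \<cdot>\<^bsub>Y\<^esub> h y"
  shows "cycle_set Y"
proof
  interpret X: cycle_set X by (rule X)
  show "carrier Y \<noteq> {}" using X.nonempty im by auto
  show "bij_betw (\<lambda>c. b \<cdot>\<^bsub>Y\<^esub> c) (carrier Y) (carrier Y)" if b: "b \<in> carrier Y" for b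
  proof -
    obtain x where x: "x \<in> carrier X" "b = h x" using b im by auto
    have "(\<lambda>c. b \<cdot>\<^bsub>Y\<^esub> c) ` carrier Y = h ` (\<lambda>y. x \<cdot>\<^bsub>X\<^esub> y) ` carrier X"
      unfolding im[symmetric] image_image using x hom by (intro image_cong) auto
    also have "\<dots> = carrier Y"
      using X.left_bij[OF x(1)] im by (simp add: bij_betw_def)
    finally have surj: "(\<lambda>c. b \<cdot>\<^bsub>Y\<^esub> c) ` carrier Y = carrier Y" .
    moreover have "finite (carrier Y)" using fin im by (metis finite_imageI)
    ultimately show ?thesis
      by (simp add: bij_betw_def finite_surj_inj)
  qed
  show "(a \<cdot>\<^bsub>Y\<^esub> b) \<cdot>\<^bsub>Y\<^esub> (a \<cdot>\<^bsub>Y\<^esub> c) = (b \<cdot>\<^bsub>Y\<^esub> a) \<cdot>\<^bsub>Y\<^esub> (b \<cdot>\<^bsub>Y\<^esub> c)"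
    if abc: "a \<in> carrier Y" "b \<in> carrier Y" "c \<in> carrier Y" for a b c
  proof -
    obtain x y z where "x \<in> carrier X" "y \<in> carrier X" "z \<in> carrier X"
      "a = h x" "b = h y" "c = h z" using abc unfolding im[symmetric] by blast
    then show ?thesis
      using X.cycle_law[of x y z] by (simp add: X.dot_closed flip: hom)
  qed
qed

context cycle_set
begin

text \<open>The representatives of the classes of equal left multiplication that form \<open>retraction_copy X\<close>.\<close>

definition rep :: "'a \<Rightarrow> 'a" where
  "rep x = inv_into (carrier X) (left_mult X) (left_mult X x)"

lemma rep_in_carrier: "x \<in> carrier X \<Longrightarrow> rep x \<in> carrier X"
  by (simp add: rep_def inv_into_into)

lemma left_mult_rep: "x \<in> carrier X \<Longrightarrow> left_mult X (rep x) = left_mult X x"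
  by (simp add: rep_def f_inv_into_f)

lemma rep_eq_iff:
  "\<lbrakk>x \<in> carrier X; y \<in> carrier X\<rbrakk> \<Longrightarrow> rep x = rep y \<longleftrightarrow> left_mult X x = left_mult X y"
  by (metis left_mult_rep rep_def)

lemma carrier_retraction_copy: "carrier (retraction_copy X) = rep ` carrier X"
  by (simp add: retraction_copy_def transport_def retraction_def rep_def image_image)

lemma retraction_copy_dot:
  assumes "x \<in> carrier X" "y \<in> carrier X"
  shows "rep x \<cdot>\<^bsub>retraction_copy X\<^esub> rep y = rep (x \<cdot> y)"
proof -
  let ?h = "inv_into (carrier X) (left_mult X)"
  have h: "rep x = ?h (left_mult X x)" for x by (simp add: rep_def)
  have mem: "left_mult X x \<in> carrier (retraction X)" if "x \<in> carrier X" for x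
    using that by (simp add: retraction_def)
  have "rep x \<cdot>\<^bsub>retraction_copy X\<^esub> rep y =
      ?h (left_mult X x \<cdot>\<^bsub>retraction X\<^esub> left_mult X y)"
    using retraction_copy_iso assms mem by (simp add: lmagma_iso_def h)
  then show ?thesis
    using retraction_dot assms by (simp add: h)
qed

lemma retraction_copy_cycle_set:
  assumes "finite (carrier X)"
  shows "cycle_set (retraction_copy X)"
  by (rule hom_image_finite_cycle_set[of X rep])
    (use assms cycle_set_axioms in \<open>auto simp: carrier_retraction_copy retraction_copy_dot\<close>)

text \<open>
  A surjective homomorphism that identifies exactly the elements with equal left multiplication
  is itself the isomorphism, because the retraction copy is a system of representatives inside
  \<open>X\<close>. No choice of representatives enters, so the same \<open>q\<close> can be followed through
  repeated retraction.
\<close>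

lemma retraction_copy_iso_of_kernel:
  assumes im: "q ` carrier X = carrier Z"
    and hom: "\<And>x y. \<lbrakk>x \<in> carrier X; y \<in> carrier X\<rbrakk> \<Longrightarrow> q (x \<cdot> y) = q x \<cdot>\<^bsub>Z\<^esub> q y"
    and ker: "\<And>x y. \<lbrakk>x \<in> carrier X; y \<in> carrier X\<rbrakk>
      \<Longrightarrow> q x = q y \<longleftrightarrow> left_mult X x = left_mult X y"
  shows "lmagma_iso q (retraction_copy X) Z"
proof -
  have q_rep: "q (rep x) = q x" if "x \<in> carrier X" for x
    using that ker rep_in_carrier left_mult_rep by simp
  have "inj_on q (carrier (retraction_copy X))"
    by (auto simp: inj_on_def carrier_retraction_copy q_rep ker rep_eq_iff)
  moreover have "q ` carrier (retraction_copy X) = carrier Z"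
    by (simp add: carrier_retraction_copy image_image q_rep flip: im)
  ultimately show ?thesis
    by (auto simp: lmagma_iso_def bij_betw_def carrier_retraction_copy retraction_copy_dot
        q_rep hom dot_closed)
qed

lemma left_mult_eq_iff_of_iso:
  assumes h: "lmagma_iso h X Y" and x: "x \<in> carrier X" "x' \<in> carrier X"
  shows "left_mult X x = left_mult X x' \<longleftrightarrow> left_mult Y (h x) = left_mult Y (h x')"
proof -
  have inj: "inj_on h (carrier X)" and im: "h ` carrier X = carrier Y"
    using h by (auto simp: lmagma_iso_def bij_betw_def)
  have "left_mult Y (h x) = left_mult Y (h x') \<longleftrightarrow>
      (\<forall>z\<in>carrier X. h x \<cdot>\<^bsub>Y\<^esub> h z = h x' \<cdot>\<^bsub>Y\<^esub> h z)"
    by (simp add: left_mult_eq_iff flip: im)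
  also have "\<dots> \<longleftrightarrow> (\<forall>z\<in>carrier X. h (x \<cdot> z) = h (x' \<cdot> z))"
    using h x by (simp add: lmagma_iso_def)
  also have "\<dots> \<longleftrightarrow> (\<forall>z\<in>carrier X. x \<cdot> z = x' \<cdot> z)"
    using x by (intro ball_cong refl inj_on_eq_iff[OF inj] dot_closed)
  finally show ?thesis
    by (simp add: left_mult_eq_iff)
qed

end

section \<open>Powers of a full cycle\<close>

text \<open>
  The restriction to \<open>{..<N}\<close> puts rotations among the extensional functions, which are the
  elements of \<open>BijGroup {..<N}\<close>.
\<close>

definition rotation :: "nat \<Rightarrow> nat \<Rightarrow> nat \<Rightarrow> nat" where
  "rotation N a = (\<lambda>y\<in>{..<N}. (y + a) mod N)"

lemma rotation_in_Bij: "rotation N a \<in> Bij {..<N}"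
proof -
  have "inj_on (rotation N a) {..<N}"
    by (auto simp: inj_on_def rotation_def mod_add_right_eq
        dest!: cong_add_rcancel_nat[unfolded cong_def, THEN iffD1])
  moreover have "rotation N a ` {..<N} \<subseteq> {..<N}"
    by (auto simp: rotation_def)
  ultimately have "bij_betw (rotation N a) {..<N} {..<N}"
    by (simp add: bij_betw_def endo_inj_surj)
  then show ?thesis
    by (simp add: Bij_def rotation_def)
qed

lemma restrict_cycle_of_list_upt: "restrict (cycle_of_list [0..<N]) {..<N} = rotation N 1"
proof
  fix y
  show "restrict (cycle_of_list [0..<N]) {..<N} y = rotation N 1 y"
  proof (cases "y < N")
    case True
    have "cycle_of_list [0..<N] ([0..<N] ! y) = rotate 1 [0..<N] ! y"
      using arg_cong[OF cyclic_rotation[of "[0..<N]" 1], of "\<lambda>cs. cs ! y"] True by simp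
    then show ?thesis
      using True by (simp add: nth_rotate1 rotation_def)
  qed (simp add: rotation_def)
qed

lemma rotation_pow: "rotation N 1 [^]\<^bsub>BijGroup {..<N}\<^esub> (a :: nat) = rotation N a"
proof (induction a)
  case 0
  show ?case by (auto simp: BijGroup_def rotation_def)
next
  case (Suc a)
  have "compose {..<N} (rotation N a) (rotation N 1) = rotation N (Suc a)"
    by (auto simp: compose_def rotation_def mod_add_left_eq)
  then show ?case
    using Suc by (simp add: BijGroup_def rotation_in_Bij)
qed

lemma closed_under_Suc_mod:
  fixes N :: nat
  assumes "y \<in> Y" and "Y \<subseteq> {..<N}" and closed: "\<And>y. y \<in> Y \<Longrightarrow> (y + 1) mod N \<in> Y"
  shows "Y = {..<N}"
proof -
  have orbit: "(y + a) mod N \<in> Y" for a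
  proof (induction a)
    case 0
    show ?case using assms(1,2) by auto
  next
    case (Suc a)
    show ?case using closed[OF Suc] by (simp add: mod_Suc_eq)
  qed
  have "z \<in> Y" if "z < N" for z
    \<comment> \<open>\<open>N - y\<close> steps lead from \<open>y\<close> to \<open>0\<close>, and \<open>z\<close> more to \<open>z\<close>.\<close>
    using orbit[of "N - y + z"] assms(1,2) that by auto
  with assms(2) show ?thesis by auto
qed

section \<open>Towers of cyclic shifts\<close>

definition tail_sum :: "(nat \<Rightarrow> nat) \<Rightarrow> (nat \<Rightarrow> nat \<Rightarrow> nat) \<Rightarrow> nat \<Rightarrow> nat \<Rightarrow> nat \<Rightarrow> nat" where
  "tail_sum N F n i x = (\<Sum>m=i..<n. N m * F m x)"

text \<open>
  The moduli form a chain under divisibility, so that reduction leads from each level to the next.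
  The assumption \<open>tail_inj\<close> is what makes each retraction step cut the modulus down to exactly
  \<open>N (Suc i)\<close>, and \<open>tail_sym\<close> is the cycle law with the variable acted upon removed.
\<close>

locale shift_tower =
  fixes n :: nat and N :: "nat \<Rightarrow> nat" and F :: "nat \<Rightarrow> nat \<Rightarrow> nat" and C :: "nat lmagma"
  assumes n_pos: "0 < n"
    and N_pos: "\<And>i. i \<le> n \<Longrightarrow> 0 < N i"
    and N_last: "N n = 1"
    and N_dvd_Suc: "\<And>i. i < n \<Longrightarrow> N (Suc i) dvd N i"
    and F_cong: "\<And>m x y. \<lbrakk>0 < m; m < n; [x = y] (mod N m)\<rbrakk> \<Longrightarrow> F m x = F m y"
    and F_0: "\<And>m. \<lbrakk>0 < m; m < n\<rbrakk> \<Longrightarrow> F m 0 = 0"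
    and tail_inj: "\<And>i x y. \<lbrakk>i < n; [tail_sum N F n (Suc i) x = tail_sum N F n (Suc i) y] (mod N i)\<rbrakk>
      \<Longrightarrow> [x = y] (mod N (Suc i))"
    and tail_sym: "\<And>x y. \<lbrakk>x < N 0; y < N 0\<rbrakk> \<Longrightarrow>
      [tail_sum N F n 1 x + tail_sum N F n 1 (y + 1 + tail_sum N F n 1 x) =
       tail_sum N F n 1 y + tail_sum N F n 1 (x + 1 + tail_sum N F n 1 y)] (mod N 0)"
    and carrier_C: "carrier C = {..<N 0}"
    and dot_C: "\<And>x y. \<lbrakk>x < N 0; y < N 0\<rbrakk>
      \<Longrightarrow> x \<cdot>\<^bsub>C\<^esub> y = (y + 1 + tail_sum N F n 1 x) mod N 0"
begin

abbreviation s :: "nat \<Rightarrow> nat \<Rightarrow> nat" where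
  "s \<equiv> tail_sum N F n"

lemma N_dvd:
  assumes "i \<le> m" "m \<le> n"
  shows "N m dvd N i"
  using assms
proof (induction m rule: dec_induct)
  case (step m)
  then show ?case using N_dvd_Suc[of m] dvd_trans by auto
qed simp

text \<open>
  The next two lemmas make the tower triangular: later summands of \<open>s i\<close> have arguments known
  modulo \<open>N i\<close>, and earlier ones are multiples of \<open>N r\<close>.
\<close>

lemma tail_sum_cong:
  assumes "0 < i" "i \<le> n" "[x = y] (mod N i)"
  shows "s i x = s i y"
  unfolding tail_sum_def
proof (rule sum.cong)
  fix m assume m: "m \<in> {i..<n}"
  then have "[x = y] (mod N m)"
    using assms N_dvd[of i m] cong_dvd_modulus_nat by auto
  then show "N m * F m x = N m * F m y"
    using F_cong[of m x y] assms m by simp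
qed simp

lemma tail_sum_drop:
  assumes "0 < i" "i \<le> Suc r" "r < n"
  shows "[s i x = s (Suc r) x] (mod N r)"
proof -
  have "s i x = (\<Sum>m=i..<Suc r. N m * F m x) + s (Suc r) x"
    unfolding tail_sum_def using assms by (intro sum.atLeastLessThan_concat[symmetric]) auto
  moreover have "N r dvd (\<Sum>m=i..<Suc r. N m * F m x)"
    using assms N_dvd[of _ r] by (intro dvd_sum dvd_mult2) auto
  ultimately show ?thesis
    by (metis add_0 cong_add_rcancel_0_nat cong_0_iff cong_add_rcancel_nat)
qed

text \<open>The candidate for the \<open>i\<close>-th retraction, living on the residues modulo \<open>N i\<close>.\<close>

definition level :: "nat \<Rightarrow> nat lmagma" where
  "level i = \<lparr>carrier = {..<N i}, dot = (\<lambda>x y. (y + 1 + s (Suc i) x) mod N i)\<rparr>"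

lemma left_mult_level_eq_iff:
  assumes "i < n"
  shows "left_mult (level i) x = left_mult (level i) y \<longleftrightarrow> [x = y] (mod N (Suc i))"
proof
  assume eq: "left_mult (level i) x = left_mult (level i) y"
  have "0 \<in> carrier (level i)"
    using N_pos[of i] assms by (simp add: level_def)
  then have "x \<cdot>\<^bsub>level i\<^esub> 0 = y \<cdot>\<^bsub>level i\<^esub> 0"
    using eq unfolding left_mult_eq_iff by blast
  then have "(1 + s (Suc i) x) mod N i = (1 + s (Suc i) y) mod N i"
    by (simp add: level_def)
  then have "[s (Suc i) x = s (Suc i) y] (mod N i)"
    using cong_add_lcancel_nat unfolding cong_def by blast
  then show "[x = y] (mod N (Suc i))"
    using tail_inj assms by blast
next
  assume "[x = y] (mod N (Suc i))"
  then have "s (Suc i) x = s (Suc i) y"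
    using assms by (intro tail_sum_cong) auto
  then show "left_mult (level i) x = left_mult (level i) y"
    by (simp add: left_mult_eq_iff level_def)
qed

lemma level_hom:
  assumes "i < n"
  shows "(x \<cdot>\<^bsub>level i\<^esub> y) mod N (Suc i) = (x mod N (Suc i)) \<cdot>\<^bsub>level (Suc i)\<^esub> (y mod N (Suc i))"
proof (cases "Suc i < n")
  case True
  have "[s (Suc i) x = s (Suc (Suc i)) x] (mod N (Suc i))"
    using True by (intro tail_sum_drop) auto
  moreover have "s (Suc (Suc i)) x = s (Suc (Suc i)) (x mod N (Suc i))"
    using True N_dvd[of "Suc i" "Suc (Suc i)"]
    by (intro tail_sum_cong) (auto simp: cong_def mod_mod_cancel)
  ultimately have "[y + 1 + s (Suc i) x = y mod N (Suc i) + 1 + s (Suc (Suc i)) (x mod N (Suc i))]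
      (mod N (Suc i))"
    by (intro cong_add) (auto simp: cong_def)
  then show ?thesis
    using N_dvd_Suc[OF assms] by (simp add: level_def mod_mod_cancel cong_def)
next
  case False
  then have "N (Suc i) = 1"
    using assms N_last by (metis Suc_lessI)
  then show ?thesis by (simp add: level_def)
qed

text \<open>
  In \<open>(x \<cdot> y) \<cdot> (x \<cdot> z)\<close> the two shifts \<open>1 + s 1 x\<close> and \<open>1 + s 1 (x \<cdot> y)\<close> add up to \<open>2\<close> plus the
  left-hand side of \<open>tail_sym\<close>.
\<close>

lemma cycle_set_C: "cycle_set C"
proof
  show "carrier C \<noteq> {}" using N_pos[of 0] by (auto simp: carrier_C)
  show "bij_betw (\<lambda>y. x \<cdot>\<^bsub>C\<^esub> y) (carrier C) (carrier C)" if "x \<in> carrier C" for x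
  proof -
    have "bij_betw (rotation (N 0) (1 + s 1 x)) (carrier C) (carrier C)"
      using rotation_in_Bij by (simp add: Bij_def carrier_C)
    then show ?thesis
      by (rule bij_betw_cong[THEN iffD1, rotated])
        (use that in \<open>simp add: carrier_C dot_C rotation_def add.assoc\<close>)
  qed
  show "(x \<cdot>\<^bsub>C\<^esub> y) \<cdot>\<^bsub>C\<^esub> (x \<cdot>\<^bsub>C\<^esub> z) = (y \<cdot>\<^bsub>C\<^esub> x) \<cdot>\<^bsub>C\<^esub> (y \<cdot>\<^bsub>C\<^esub> z)"
    if "x \<in> carrier C" "y \<in> carrier C" "z \<in> carrier C" for x y z
  proof -
    have dot: "(x \<cdot>\<^bsub>C\<^esub> y) \<cdot>\<^bsub>C\<^esub> (x \<cdot>\<^bsub>C\<^esub> z) =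
        (z + 2 + (s 1 x + s 1 (y + 1 + s 1 x))) mod N 0"
      if "x < N 0" "y < N 0" "z < N 0" for x y
    proof -
      have "[(y + 1 + s 1 x) mod N 0 = y + 1 + s 1 x] (mod N 1)"
        using N_dvd[of 0 1] n_pos by (auto simp: cong_def mod_mod_cancel)
      then have "s 1 ((y + 1 + s 1 x) mod N 0) = s 1 (y + 1 + s 1 x)"
        using n_pos by (intro tail_sum_cong) auto
      moreover have "((z + 1 + s 1 x) mod N 0 + 1 + t) mod N 0 = (z + 2 + (s 1 x + t)) mod N 0" for t
        by (simp only: add.assoc mod_add_left_eq) (simp add: algebra_simps)
      ultimately show ?thesis
        using that N_pos[of 0] by (simp add: dot_C)
    qed
    have "[z + 2 + (s 1 x + s 1 (y + 1 + s 1 x)) = z + 2 + (s 1 y + s 1 (x + 1 + s 1 y))] (mod N 0)"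
      using tail_sym[of x y] that unfolding cong_add_lcancel_nat by (simp add: carrier_C)
    then show ?thesis
      using that by (simp add: dot carrier_C cong_def)
  qed
qed

text \<open>
  Equality of squares modulo \<open>N 0\<close> forces congruence modulo every \<open>N r\<close>, by descent from
  \<open>N n = 1\<close>: agreement modulo \<open>N (Suc r)\<close> equates the only part of \<open>s 1\<close> that is visible
  modulo \<open>N r\<close>.
\<close>

lemma nondegenerate_C: "nondegenerate C"
proof -
  have descent: "[x = y] (mod N r)"
    if "[x + s 1 x = y + s 1 y] (mod N 0)" "r \<le> n" for x y r
    using that(2)
  proof (induction r rule: inc_induct)
    case base
    show ?case by (simp add: N_last)
  next
    case (step r)
    have "[x + s 1 x = y + s 1 y] (mod N r)"
      using that(1) N_dvd[of 0 r] step.hyps cong_dvd_modulus_nat by auto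
    moreover have "[z + s 1 z = z + s (Suc r) z] (mod N r)" for z
      using tail_sum_drop[of 1 r z] step.hyps by (intro cong_add) auto
    moreover have "s (Suc r) x = s (Suc r) y"
      using step by (intro tail_sum_cong) auto
    ultimately show ?case
      by (metis cong_add_rcancel_nat cong_sym cong_trans)
  qed
  have "inj_on (\<lambda>x. x \<cdot>\<^bsub>C\<^esub> x) (carrier C)"
  proof
    fix x y assume xy: "x \<in> carrier C" "y \<in> carrier C" "x \<cdot>\<^bsub>C\<^esub> x = y \<cdot>\<^bsub>C\<^esub> y"
    then have "[1 + (x + s 1 x) = 1 + (y + s 1 y)] (mod N 0)"
      by (simp add: carrier_C dot_C cong_def)
    then have "[x = y] (mod N 0)"
      using descent cong_add_lcancel_nat by blast
    then show "x = y"
      using xy by (simp add: carrier_C cong_def)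
  qed
  moreover have "(\<lambda>x. x \<cdot>\<^bsub>C\<^esub> x) ` carrier C \<subseteq> carrier C"
    using cycle_set.dot_closed[OF cycle_set_C] by auto
  ultimately show ?thesis
    by (simp add: nondegenerate_def bij_betw_def endo_inj_surj carrier_C)
qed

text \<open>
  The iterated retractions are nested sets of representatives inside \<open>{..<N 0}\<close>, so one formula,
  reduction modulo \<open>N i\<close>, gives the isomorphism at every stage. At each step
  \<open>retraction_copy_iso_of_kernel\<close> applies: reduction modulo \<open>N (Suc i)\<close> factors through \<open>level i\<close>
  and has there the kernel given by \<open>left_mult_level_eq_iff\<close>.
\<close>

lemma iter_retraction_iso_level:
  assumes "i \<le> n"
  shows "cycle_set (iter_retraction i C) \<and>
    lmagma_iso (\<lambda>x. x mod N i) (iter_retraction i C) (level i)"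
  using assms
proof (induction i)
  case 0
  have "x mod N 0 = x" if "x \<in> carrier C" for x
    using that by (simp add: carrier_C)
  then have "bij_betw (\<lambda>x. x mod N 0) (carrier C) (carrier C)"
    by (subst bij_betw_cong[of _ _ id]) simp_all
  then show ?case
    using cycle_set_C N_pos[of 0]
    by (auto simp: iter_retraction_def lmagma_iso_def level_def carrier_C dot_C)
next
  case (Suc i)
  define Y where "Y = iter_retraction i C"
  have Suc_Y: "iter_retraction (Suc i) C = retraction_copy Y"
    by (simp add: iter_retraction_def Y_def)
  have i: "i < n" and Y: "cycle_set Y" and iso: "lmagma_iso (\<lambda>x. x mod N i) Y (level i)"
    using Suc by (auto simp: Y_def)
  have mod_mod: "x mod N i mod N (Suc i) = x mod N (Suc i)" for x
    using N_dvd_Suc[OF i] by (rule mod_mod_cancel)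
  have im: "(\<lambda>x. x mod N i) ` carrier Y = {..<N i}"
    using iso by (simp add: lmagma_iso_def bij_betw_def level_def)
  have "finite (carrier Y)"
    using iso bij_betw_finite by (fastforce simp: lmagma_iso_def level_def)
  then have "cycle_set (retraction_copy Y)"
    using Y cycle_set.retraction_copy_cycle_set by blast
  moreover have "lmagma_iso (\<lambda>x. x mod N (Suc i)) (retraction_copy Y) (level (Suc i))"
  proof (rule cycle_set.retraction_copy_iso_of_kernel[OF Y])
    have "(\<lambda>x. x mod N (Suc i)) ` carrier Y = (\<lambda>x. x mod N (Suc i)) ` (\<lambda>x. x mod N i) ` carrier Y"
      by (simp add: image_image mod_mod)
    also have "\<dots> = {..<N (Suc i)}"
    proof -
      have "N (Suc i) \<le> N i" "0 < N (Suc i)"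
        using N_dvd_Suc[OF i] N_pos i by (auto intro: dvd_imp_le)
      then have "y \<in> (\<lambda>x. x mod N (Suc i)) ` {..<N i}" if "y < N (Suc i)" for y
        using that by (intro image_eqI[of _ _ y]) auto
      then show ?thesis
        unfolding im using \<open>0 < N (Suc i)\<close> by auto
    qed
    finally show "(\<lambda>x. x mod N (Suc i)) ` carrier Y = carrier (level (Suc i))"
      by (simp add: level_def)
  next
    fix x y assume "x \<in> carrier Y" "y \<in> carrier Y"
    then have "(x \<cdot>\<^bsub>Y\<^esub> y) mod N i = (x mod N i) \<cdot>\<^bsub>level i\<^esub> (y mod N i)"
      using iso by (simp add: lmagma_iso_def)
    then have "(x \<cdot>\<^bsub>Y\<^esub> y) mod N (Suc i) = ((x mod N i) \<cdot>\<^bsub>level i\<^esub> (y mod N i)) mod N (Suc i)"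
      using mod_mod by metis
    then show "(x \<cdot>\<^bsub>Y\<^esub> y) mod N (Suc i) =
        (x mod N (Suc i)) \<cdot>\<^bsub>level (Suc i)\<^esub> (y mod N (Suc i))"
      by (simp add: level_hom[OF i] mod_mod)
  next
    fix x y assume "x \<in> carrier Y" "y \<in> carrier Y"
    then have "left_mult Y x = left_mult Y y \<longleftrightarrow> [x mod N i = y mod N i] (mod N (Suc i))"
      using cycle_set.left_mult_eq_iff_of_iso[OF Y iso] left_mult_level_eq_iff[OF i] by simp
    then show "x mod N (Suc i) = y mod N (Suc i) \<longleftrightarrow> left_mult Y x = left_mult Y y"
      by (simp add: cong_def mod_mod)
  qed
  ultimately show ?case
    by (simp add: Suc_Y)
qed

lemma card_iter_retraction:
  assumes "i \<le> n"
  shows "card (carrier (iter_retraction i C)) = N i"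
  using iter_retraction_iso_level[OF assms] bij_betw_same_card
  by (fastforce simp: lmagma_iso_def level_def)

lemma multipermutational_level_C:
  assumes "\<And>i. i < n \<Longrightarrow> N i \<noteq> 1"
  shows "multipermutational_level C n"
  using assms by (simp add: multipermutational_level_def nondegenerate_C card_iter_retraction N_last)

lemma left_mult_C: "x < N 0 \<Longrightarrow> left_mult C x = rotation (N 0) (1 + s 1 x)"
  by (auto simp: left_mult_def rotation_def carrier_C dot_C fun_eq_iff add.assoc)

lemma left_mult_C_0: "left_mult C 0 = rotation (N 0) 1"
proof -
  have "s 1 0 = 0"
    by (simp add: tail_sum_def F_0)
  then show ?thesis
    using left_mult_C[of 0] N_pos[of 0] by simp
qed

lemma indecomposable_C: "indecomposable C"
  unfolding indecomposable_def
proof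
  assume "\<exists>Y Z. Y \<noteq> {} \<and> Z \<noteq> {} \<and> Y \<inter> Z = {} \<and> Y \<union> Z = carrier C \<and>
    (\<forall>x\<in>carrier C. left_mult C x ` Y \<subseteq> Y \<and> left_mult C x ` Z \<subseteq> Z)"
  moreover have "0 \<in> carrier C"
    using N_pos[of 0] by (simp add: carrier_C)
  ultimately obtain Y Z where YZ: "Y \<noteq> {}" "Z \<noteq> {}" "Y \<inter> Z = {}" "Y \<union> Z = carrier C"
    and closed: "left_mult C 0 ` Y \<subseteq> Y" "left_mult C 0 ` Z \<subseteq> Z"
    by metis
  have full: "W = {..<N 0}"
    if W: "W \<noteq> {}" "W \<subseteq> {..<N 0}" "left_mult C 0 ` W \<subseteq> W" for W
  proof -
    obtain w where "w \<in> W" using W by blast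
    moreover have "(v + 1) mod N 0 \<in> W" if "v \<in> W" for v
    proof -
      have "rotation (N 0) 1 v \<in> W" using W(3) that left_mult_C_0 by auto
      moreover have "v < N 0" using W(2) that by auto
      ultimately show ?thesis by (simp add: rotation_def)
    qed
    ultimately show ?thesis
      using W(2) by (intro closed_under_Suc_mod)
  qed
  have "Y \<subseteq> {..<N 0}" "Z \<subseteq> {..<N 0}"
    using YZ(4) by (auto simp: carrier_C)
  then have "Y = {..<N 0}" "Z = {..<N 0}"
    using full YZ(1,2) closed by simp_all
  then show False
    using YZ by simp
qed

lemma perm_group_C:
  "perm_group C = subgroup_generated (BijGroup {..<N 0}) {rotation (N 0) 1}"
proof -
  let ?G = "BijGroup {..<N 0}" and ?r = "rotation (N 0) 1"
  interpret G: group ?G by (rule group_BijGroup)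
  have carrier: "carrier ?G = Bij {..<N 0}" by (simp add: BijGroup_def)
  have r: "{?r} \<subseteq> carrier ?G" by (simp add: carrier rotation_in_Bij)
  have S: "left_mult C ` carrier C \<subseteq> carrier ?G"
    by (auto simp: carrier carrier_C left_mult_C rotation_in_Bij)
  have sub: "subgroup (generate ?G {?r}) ?G"
    using r by (rule G.generate_is_subgroup)
  have "generate ?G (left_mult C ` carrier C) \<subseteq> generate ?G {?r}"
  proof (rule G.generate_subgroup_incl[OF _ sub])
    have "?r [^]\<^bsub>?G\<^esub> a \<in> generate ?G {?r}" for a :: nat
      by (induction a) (simp_all add: generate.one generate.incl generate.eng)
    then have "rotation (N 0) a \<in> generate ?G {?r}" for a
      by (simp only: rotation_pow)
    then show "left_mult C ` carrier C \<subseteq> generate ?G {?r}"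
      by (auto simp: carrier_C left_mult_C)
  qed
  moreover have "generate ?G {?r} \<subseteq> generate ?G (left_mult C ` carrier C)"
    using left_mult_C_0 N_pos[of 0]
    by (intro G.mono_generate) (auto simp: carrier_C intro!: image_eqI[of _ _ 0])
  ultimately have "generate ?G (left_mult C ` carrier C) = generate ?G {?r}" by blast
  then show ?thesis
    using r S by (simp add: perm_group_def subgroup_generated_def carrier_C Int_absorb1)
qed

end

section \<open>The construction over a prime power\<close>

theorem theorem8:
  fixes p k n :: nat and j :: "nat \<Rightarrow> nat" and f :: "nat \<Rightarrow> nat \<Rightarrow> nat"
    and X :: "nat set" and F :: "nat \<Rightarrow> nat \<Rightarrow> nat" and \<phi> :: "nat \<Rightarrow> nat \<Rightarrow> nat"
    and \<psi> :: "nat \<Rightarrow> nat" and \<sigma> :: "nat \<Rightarrow> nat \<Rightarrow> nat" and K Q :: "nat \<Rightarrow> nat \<Rightarrow> nat"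
    and C :: "nat lmagma"
  defines "X \<equiv> {0..p ^ k - 1}"
  \<comment> \<open>\<open>f m\<close> is given on the residues \<open>{..<p ^ j m}\<close> representing the integers modulo \<open>p ^ j m\<close>;
      \<open>F m l\<close> is its value at the class of the integer \<open>l\<close>.\<close>
  defines "F \<equiv> \<lambda>m l. f m (l mod p ^ j m)"
  defines "\<phi> \<equiv> \<lambda>i l. 1 + (\<Sum>m=i..n - 1. p ^ j m * F m l)"
  defines "\<psi> \<equiv> restrict (cycle_of_list [0..<p ^ k]) X"
  defines "\<sigma> \<equiv> \<lambda>x. \<psi> [^]\<^bsub>BijGroup X\<^esub> (1 + (\<Sum>m=1..n - 1. p ^ j m * F m x))"
  defines "K \<equiv> \<lambda>y x. y + 1 + (\<Sum>m=2..n - 1. p ^ j m * F m x)"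
  defines "Q \<equiv> \<lambda>y x. (\<Sum>m=1..n - 1. p ^ j m * F m x) + (\<Sum>m=1..n - 1. p ^ j m * F m (K y x))"
  defines "C \<equiv> \<lparr>carrier = X, dot = (\<lambda>x y. \<sigma> x y)\<rparr>"
  assumes "prime p" and "n \<ge> 2"
    and "j n = 0" and "j 0 = k" and "\<And>i. i \<in> {1..n} \<Longrightarrow> j i < j (i - 1)"
    and "\<And>i. i \<in> {1..n - 1} \<Longrightarrow> f i \<in> {..<p ^ j i} \<rightarrow> {0..p ^ j (i - 1) div p ^ j i - 1}"
    and "\<And>i. i \<in> {1..n - 1} \<Longrightarrow> f i 0 = 0"
    and "\<And>i. i \<in> {1..n - 1} \<Longrightarrow> \<phi> i \<in> {0..p ^ j i - 1} \<rightarrow> {1..p ^ j (i - 1) - 1}"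
    and "\<And>i. i \<in> {1..n - 1} \<Longrightarrow> inj_on (\<phi> i) {0..p ^ j i - 1}"
    and "\<And>x y. x \<in> X \<Longrightarrow> y \<in> X \<Longrightarrow> [Q x y = Q y x] (mod p ^ k)"
  shows "cycle_set C \<and> indecomposable C \<and> multipermutational_level C n \<and>
    cyclic_group (perm_group C) \<and>
    perm_group C = subgroup_generated (BijGroup X) {\<psi>} \<and>
    (\<forall>i\<in>{0..n}. card (carrier (iter_retraction i C)) = p ^ j i)"
proof -
  define N where "N i = p ^ j i" for i
  define s where "s = tail_sum N F n"
  have p: "1 < p" using \<open>prime p\<close> by (rule prime_gt_1_nat)
  have N_pos: "0 < N i" for i using p by (simp add: N_def)
  have N0: "N 0 = p ^ k" using \<open>j 0 = k\<close> by (simp add: N_def)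
  have X: "X = {..<N 0}"
    using N_pos[of 0] unfolding X_def N0 by (auto simp: less_eq_Suc_le)
  have s: "(\<Sum>m=i..n - 1. p ^ j m * F m x) = s i x" for i x
  proof -
    have "{i..n - 1} = {i..<n}" using \<open>n \<ge> 2\<close> by auto
    then show ?thesis by (simp add: s_def tail_sum_def N_def)
  qed
  have \<psi>: "\<psi> = rotation (N 0) 1"
    by (simp add: \<psi>_def X restrict_cycle_of_list_upt flip: N0)
  have \<sigma>: "\<sigma> x = rotation (N 0) (1 + s 1 x)" for x
    unfolding \<sigma>_def s X \<psi> by (rule rotation_pow)
  note j_less = assms(13) and f_0 = assms(15) and \<phi>_range = assms(16) and \<phi>_inj = assms(17)
    and Q_sym = assms(18)
  have N_dvd: "N m dvd N i" if "i \<le> m" "m \<le> n" for i m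
  proof -
    have "j m \<le> j i"
      using that
    proof (induction m rule: dec_induct)
      case (step m)
      then show ?case using j_less[of "Suc m"] by simp
    qed simp
    then show ?thesis by (simp add: N_def le_imp_power_dvd)
  qed
  have F_cong: "F m x = F m y" if "[x = y] (mod N m)" for m x y
    using that by (simp add: F_def N_def cong_def)

  have "shift_tower n N F C"
  proof
    show "0 < n" using \<open>n \<ge> 2\<close> by simp
    show "0 < N i" for i by (rule N_pos)
    show "N n = 1" using \<open>j n = 0\<close> by (simp add: N_def)
    show "N (Suc i) dvd N i" if "i < n" for i
      using that by (intro N_dvd) auto
    show "F m x = F m y" if "[x = y] (mod N m)" for m x y
      using that by (rule F_cong)
    show "F m 0 = 0" if "0 < m" "m < n" for m
      using f_0[of m] that by (simp add: F_def)
    show "[x = y] (mod N (Suc i))"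
      if i: "i < n" and eq: "[tail_sum N F n (Suc i) x = tail_sum N F n (Suc i) y] (mod N i)"
      for i x y
    \<comment> \<open>At the last step the modulus \<open>N n\<close> is 1, and no \<open>\<phi>\<close> is available.\<close>
    proof (cases "Suc i = n")
      case True
      then show ?thesis using \<open>j n = 0\<close> by (simp add: N_def)
    next
      case False
      then have mem: "Suc i \<in> {1..n - 1}" using i by auto
      let ?r = "\<lambda>z. z mod N (Suc i)"
      have \<phi>: "\<phi> (Suc i) z = 1 + s (Suc i) z" for z
        unfolding \<phi>_def s ..
      have r: "?r z \<in> {0..p ^ j (Suc i) - 1}" for z
        using mod_less_divisor[OF N_pos[of "Suc i"], of z]
        unfolding atLeastAtMost_iff N_def by linarith
      \<comment> \<open>The values of \<open>\<phi> (Suc i)\<close> lie below \<open>N i\<close>, so they are determined by their residues.\<close>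
      have small: "s (Suc i) (?r z) < N i" for z
        using funcset_mem[OF \<phi>_range[OF mem] r[of z]] N_pos[of i] by (simp add: \<phi> N_def)
      have s_r: "s (Suc i) (?r z) = s (Suc i) z" for z
        unfolding s_def tail_sum_def
      proof (rule sum.cong)
        fix m assume m: "m \<in> {Suc i..<n}"
        have "N m dvd N (Suc i)"
          using m by (intro N_dvd) auto
        then have "F m (?r z) = F m z"
          by (intro F_cong) (simp add: cong_def mod_mod_cancel)
        then show "N m * F m (?r z) = N m * F m z" by simp
      qed simp
      have "\<phi> (Suc i) (?r x) = \<phi> (Suc i) (?r y)"
        using eq small[of x] small[of y] by (simp add: \<phi> s_r cong_def flip: s_def)
      then have "?r x = ?r y"
        using inj_onD[OF \<phi>_inj[OF mem]] r by blast
      then show ?thesis by (simp add: cong_def)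
    qed
    show "[tail_sum N F n 1 x + tail_sum N F n 1 (y + 1 + tail_sum N F n 1 x) =
       tail_sum N F n 1 y + tail_sum N F n 1 (x + 1 + tail_sum N F n 1 y)] (mod N 0)"
      if "x < N 0" "y < N 0" for x y
    proof -
      \<comment> \<open>\<open>K\<close> omits the summand at index 1, a multiple of \<open>N 1\<close>, to which no \<open>F m\<close> is sensitive.\<close>
      have "Q y x = s 1 x + s 1 (y + 1 + s 1 x)" for x y
      proof -
        have "s 1 x = N 1 * F 1 x + s 2 x"
          using \<open>n \<ge> 2\<close> by (simp add: s_def tail_sum_def sum.atLeast_Suc_lessThan numeral_2_eq_2)
        then have "y + 1 + s 1 x = K y x + F 1 x * N 1"
          unfolding K_def s by simp
        then have K: "[K y x = y + 1 + s 1 x] (mod N 1)"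
          by (simp add: cong_def)
        have "F m (K y x) = F m (y + 1 + s 1 x)" if "m \<in> {1..<n}" for m
        proof -
          have "N m dvd N 1"
            using that by (intro N_dvd) auto
          with K show ?thesis
            by (intro F_cong) (rule cong_dvd_modulus_nat)
        qed
        then have "s 1 (K y x) = s 1 (y + 1 + s 1 x)"
          by (simp add: tail_sum_def s_def)
        then show ?thesis unfolding Q_def s by simp
      qed
      then show ?thesis
        using Q_sym[of y x] that by (simp add: X N0 s_def)
    qed
    show "carrier C = {..<N 0}" by (simp add: C_def X)
    show "x \<cdot>\<^bsub>C\<^esub> y = (y + 1 + tail_sum N F n 1 x) mod N 0"
      if "x < N 0" "y < N 0" for x y
      using that by (simp add: C_def \<sigma> rotation_def s_def add.assoc)
  qed
  then interpret shift_tower n N F C .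
  have "N i \<noteq> 1" if "i < n" for i
    using j_less[of "Suc i"] that p by (simp add: N_def)
  then have "multipermutational_level C n"
    by (rule multipermutational_level_C)
  moreover have "perm_group C = subgroup_generated (BijGroup X) {\<psi>}"
    using perm_group_C by (simp add: X \<psi>)
  moreover have "cyclic_group (subgroup_generated (BijGroup X) {\<psi>})"
    by (rule group.cyclic_group_generated[OF group_BijGroup])
  ultimately show ?thesis
    using cycle_set_C indecomposable_C card_iter_retraction by (simp add: N_def)
qed

end
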